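(* Assume that the infinite lower triangular array $[A_{n,k}(q)]_{n,k\geq 0}$ satisfies the recurrence $$A_{n,k}(q)=f_{n,k}(q)\,A_{n-1,k-1}(q)+g_{n,k}(q)\,A_{n-1,k}(q)+h_{n,k}(q)\,A_{n-1,k+1}(q)$$ for $n\geq 1$ and $k\geq 0$, where $A_{0,0}(q)=1$, $A_{0,k}(q)=0$ for $k>0$, and $A_{n,-1}(q)=0$ for all $n\ge 0$. Assume that, for each $n$, the three sequences of polynomials with nonnegative coefficients $(f_{n,k}(q))_{k\geq0}$, $(g_{n,k}(q))_{k\geq0}$ and $(h_{n,k}(q))_{k\geq0}$ are strongly $q$-log-concave in $k$. If \begin{align*} &f_{n,l}(q)g_{n,k}(q)+f_{n,k}(q)g_{n,l}(q)\geq_q f_{n,l+1}(q)g_{n,k-1}(q)+f_{n,k-1}(q)g_{n,l+1}(q),\\ &g_{n,l}(q)h_{n,k}(q)+g_{n,k}(q)h_{n,l}(q)\geq_q g_{n,l+1}(q)h_{n,k-1}(q)+g_{n,k-1}(q)h_{n,l+1}(q),\\ &f_{n,l}(q)h_{n,k}(q)+f_{n,k}(q)h_{n,l}(q)\geq_q f_{n,k-1}(q)h_{n,l+1}(q)+f_{n,l+1}(q)h_{n,k-1}(q),\\ &g_{n,k}(q)g_{n,l}(q)\geq_q f_{n,l+1}(q)h_{n,k-1}(q) \end{align*} for all $1\leq k\leq l\leq n$, then, for any fixed $n$, the row sequence $(A_{n,k}(q))_{0\leq k\leq n}$ is strongly $q$-log-concave in $k$. In particular, each row sequence $(A_{n,k}(q))_{0\leq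 k\leq n}$ is log-concave in $k$ for any fixed real number $q\geq0$.
   Context: For polynomials $f,g$ in $q$ with real coefficients, $f(q)\geq_q g(q)$ means that $f(q)-g(q)$ has only nonnegative coefficients. A (finite or infinite) sequence $(p_k(q))_{k\ge 0}$ of polynomials with nonnegative coefficients is strongly $q$-log-concave in $k$ if $p_k(q)p_l(q)\geq_q p_{k-1}(q)p_{l+1}(q)$ for all $l\ge k\ge 1$ for which the terms are defined. A sequence $(a_k)$ of nonnegative real numbers is log-concave if $a_{k-1}a_{k+1}\le a_k^2$ for all $k\ge 1$ for which the terms are defined. A sequence has no internal zeros if its $j$-th term is nonzero whenever $i<j<k$ and the $i$-th and $k$-th terms are both nonzero; all sequences are assumed to have no internal zeros. *)

theory Defs
  imports Complex_Main "HOL-Computational_Algebra.Polynomial"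
begin

definition q_ge :: "real poly \<Rightarrow> real poly \<Rightarrow> bool"  (infix "\<ge>\<^sub>q" 50) where
  "f \<ge>\<^sub>q g \<longleftrightarrow> (\<forall>i. 0 \<le> coeff (f - g) i)"

definition nonneg_coeffs :: "real poly \<Rightarrow> bool" where
  "nonneg_coeffs p \<longleftrightarrow> (\<forall>i. 0 \<le> coeff p i)"

text \<open>
  A finite or infinite sequence is a function on the naturals together with the set \<open>I\<close> of
  indices at which its terms are defined: \<open>{..n}\<close> for a finite sequence, \<open>UNIV\<close> for an
  infinite one. Values outside \<open>I\<close> are never consulted.
\<close>

definition no_internal_zeros :: "nat set \<Rightarrow> (nat \<Rightarrow> 'a::zero) \<Rightarrow> bool" where
  "no_internal_zeros I a \<longleftrightarrow>
     (\<forall>i\<in>I. \<forall>j\<in>I. \<forall>k\<in>I. i < j \<longrightarrow> j < k \<longrightarrow> a i \<noteq> 0 \<longrightarrow> a k \<noteq> 0 \<longrightarrow> a j \<noteq> 0)"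

text \<open>
  The standing convention that all sequences have no internal zeros is part of the two
  definitions below. For strongly q-log-concave sequences on an initial segment it already
  follows from the other clauses; for log-concave sequences of reals it does not.
\<close>

definition strongly_q_log_concave :: "nat set \<Rightarrow> (nat \<Rightarrow> real poly) \<Rightarrow> bool" where
  "strongly_q_log_concave I p \<longleftrightarrow>
     (\<forall>k\<in>I. nonneg_coeffs (p k)) \<and>
     no_internal_zeros I p \<and>
     (\<forall>k l. 1 \<le> k \<longrightarrow> k \<le> l \<longrightarrow> k - 1 \<in> I \<longrightarrow> k \<in> I \<longrightarrow> l \<in> I \<longrightarrow> l + 1 \<in> I \<longrightarrow>
        p k * p l \<ge>\<^sub>q p (k - 1) * p (l + 1))"

definition log_concave :: "nat set \<Rightarrow> (nat \<Rightarrow> real) \<Rightarrow> bool" where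
  "log_concave I a \<longleftrightarrow>
     (\<forall>k\<in>I. 0 \<le> a k) \<and>
     no_internal_zeros I a \<and>
     (\<forall>k. 1 \<le> k \<longrightarrow> k - 1 \<in> I \<longrightarrow> k \<in> I \<longrightarrow> k + 1 \<in> I \<longrightarrow>
        a (k - 1) * a (k + 1) \<le> (a k)^2)"

end

theory Submission
  imports Defs
begin

text \<open>
  Shift row \<open>n - 1\<close> to \<open>c j = A (n - 1) (j - 1)\<close> and expand \<open>b\<^sub>k b\<^sub>l - b\<^bsub>k-1\<^esub> b\<^bsub>l+1\<^esub>\<close> for the next row
  \<open>b\<^sub>k = f\<^sub>k c\<^sub>k + g\<^sub>k c\<^bsub>k+1\<^esub> + h\<^sub>k c\<^bsub>k+2\<^esub>\<close>. Grouping the eighteen products \<open>c\<^sub>i c\<^sub>j\<close> by \<open>i + j\<close> gives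
  five groups; in each of them the products form a chain under \<open>\<ge>\<^sub>q\<close> by the strong log-concavity
  of \<open>c\<close>, and summation by parts along the chain leaves exactly the coefficient combinations
  that the hypotheses make nonnegative. Induction on \<open>n\<close> then gives the theorem.
\<close>

section \<open>The coefficientwise order on real polynomials\<close>

lemma q_ge_iff: "p \<ge>\<^sub>q r \<longleftrightarrow> nonneg_coeffs (p - r)"
  by (simp add: q_ge_def nonneg_coeffs_def)

lemma q_ge_refl: "p \<ge>\<^sub>q p"
  by (simp add: q_ge_def)

lemma nonneg_coeffs_0: "nonneg_coeffs 0"
  by (simp add: nonneg_coeffs_def)

lemma nonneg_coeffs_add: "nonneg_coeffs p \<Longrightarrow> nonneg_coeffs r \<Longrightarrow> nonneg_coeffs (p + r)"
  by (simp add: nonneg_coeffs_def)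

lemma nonneg_coeffs_mult: "nonneg_coeffs p \<Longrightarrow> nonneg_coeffs r \<Longrightarrow> nonneg_coeffs (p * r)"
  by (auto simp: nonneg_coeffs_def coeff_mult intro!: sum_nonneg)

lemma nonneg_coeffs_antisym:
  assumes "nonneg_coeffs p" and "nonneg_coeffs (- p)"
  shows "p = 0"
  using assms by (intro poly_eqI) (simp add: nonneg_coeffs_def antisym)

lemma poly_nonneg_coeffs: "nonneg_coeffs p \<Longrightarrow> 0 \<le> q \<Longrightarrow> 0 \<le> poly p q"
  by (auto simp: nonneg_coeffs_def poly_altdef intro!: sum_nonneg)

lemma poly_q_ge: "p \<ge>\<^sub>q r \<Longrightarrow> 0 \<le> q \<Longrightarrow> poly r q \<le> poly p q"
  using poly_nonneg_coeffs[of "p - r" q] by (simp add: q_ge_iff)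

section \<open>Strong log-concavity on initial segments\<close>

text \<open>With a nonzero entry fixed far to the right, nonvanishing travels rightwards one index
  at a time. The premise allows any \<open>l\<close> above \<open>k\<close>, which is the form that
  a strong inequality delivers.\<close>

lemma no_internal_zeros_atMostI:
  assumes step: "\<And>k l. k < l \<Longrightarrow> l < n \<Longrightarrow> a k \<noteq> 0 \<Longrightarrow> a (Suc l) \<noteq> 0 \<Longrightarrow> a (Suc k) \<noteq> 0"
  shows "no_internal_zeros {..n} a"
  unfolding no_internal_zeros_def
proof (intro ballI impI)
  fix i j k
  assume k: "k \<in> {..n}" "j < k" "a k \<noteq> 0" and i: "i < j" "a i \<noteq> 0"
  from i(1) have "i \<le> j" by simp
  then show "a j \<noteq> 0" using k(2)
  proof (induction j rule: dec_induct)
    case base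
    show ?case by (rule i(2))
  next
    case (step m)
    then have "m < k - 1" and "k - 1 < n" and "a m \<noteq> 0"
      using k(1) by auto
    then show ?case using assms[of m "k - 1"] k by simp
  qed
qed

text \<open>If \<open>p (Suc k)\<close> vanished, the inequality would make
  \<open>p k * p (Suc l)\<close> at once nonnegative and nonpositive, hence zero, although both
  factors are nonzero.\<close>

lemma strongly_q_log_concave_atMostI:
  assumes nonneg: "\<And>k. k \<le> n \<Longrightarrow> nonneg_coeffs (p k)"
    and slc: "\<And>k l. k < l \<Longrightarrow> l < n \<Longrightarrow> p (Suc k) * p l \<ge>\<^sub>q p k * p (Suc l)"
  shows "strongly_q_log_concave {..n} p"
  unfolding strongly_q_log_concave_def
proof (intro conjI ballI allI impI)
  show "no_internal_zeros {..n} p"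
  proof (rule no_internal_zeros_atMostI)
    fix k l
    assume kl: "k < l" "l < n" "p k \<noteq> 0" "p (Suc l) \<noteq> 0"
    show "p (Suc k) \<noteq> 0"
    proof
      assume "p (Suc k) = 0"
      then have "nonneg_coeffs (- (p k * p (Suc l)))"
        using slc[OF kl(1,2)] by (simp add: q_ge_iff)
      moreover have "nonneg_coeffs (p k * p (Suc l))"
        using kl by (intro nonneg_coeffs_mult nonneg) auto
      ultimately show False
        using nonneg_coeffs_antisym kl(3,4) by fastforce
    qed
  qed
next
  fix k l
  assume "1 \<le> k" "k \<le> l" "l + 1 \<in> {..n}"
  then show "p k * p l \<ge>\<^sub>q p (k - 1) * p (l + 1)"
    using slc[of "k - 1" l] by simp
qed (use nonneg in auto)

lemma strongly_q_log_concaveD: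
  assumes "strongly_q_log_concave I p"
  shows "k \<in> I \<Longrightarrow> nonneg_coeffs (p k)"
    and "k < l \<Longrightarrow> {k, Suc k, l, Suc l} \<subseteq> I \<Longrightarrow> p (Suc k) * p l \<ge>\<^sub>q p k * p (Suc l)"
proof -
  show "k \<in> I \<Longrightarrow> nonneg_coeffs (p k)"
    using assms by (simp add: strongly_q_log_concave_def)
  have "\<forall>k l. 1 \<le> k \<longrightarrow> k \<le> l \<longrightarrow> k - 1 \<in> I \<longrightarrow> k \<in> I \<longrightarrow> l \<in> I \<longrightarrow> l + 1 \<in> I \<longrightarrow>
      p k * p l \<ge>\<^sub>q p (k - 1) * p (l + 1)"
    using assms by (simp add: strongly_q_log_concave_def)
  from this[rule_format, of "Suc k" l]
  show "k < l \<Longrightarrow> {k, Suc k, l, Suc l} \<subseteq> I \<Longrightarrow> p (Suc k) * p l \<ge>\<^sub>q p k * p (Suc l)"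
    by simp
qed

text \<open>
  The absence of internal zeros cannot be read off from the one for \<open>p\<close>: at \<open>q = 0\<close> a nonzero
  polynomial may vanish. It follows from the strong inequalities instead.
\<close>

lemma log_concave_poly:
  assumes p: "strongly_q_log_concave {..n} p" and q: "0 \<le> q"
  shows "log_concave {..n} (\<lambda>k. poly (p k) q)"
proof -
  have nonneg: "0 \<le> poly (p k) q" if "k \<le> n" for k
    using strongly_q_log_concaveD(1)[OF p] that q by (simp add: poly_nonneg_coeffs)
  have slc: "poly (p k) q * poly (p (Suc l)) q \<le> poly (p (Suc k)) q * poly (p l) q"
    if "k < l" "l < n" for k l
    using poly_q_ge[OF strongly_q_log_concaveD(2)[OF p] q] that by simp
  have "no_internal_zeros {..n} (\<lambda>k. poly (p k) q)"
  proof (rule no_internal_zeros_atMostI)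
    fix k l
    assume kl: "k < l" "l < n" "poly (p k) q \<noteq> 0" "poly (p (Suc l)) q \<noteq> 0"
    then have "0 < poly (p k) q * poly (p (Suc l)) q"
      using nonneg[of k] nonneg[of "Suc l"] by simp
    then show "poly (p (Suc k)) q \<noteq> 0"
      using slc[OF kl(1,2)] by auto
  qed
  moreover have "poly (p (k - 1)) q * poly (p (k + 1)) q \<le> (poly (p k) q)\<^sup>2"
    if "1 \<le> k" "k + 1 \<le> n" for k
    using slc[of "k - 1" k] that by (simp add: power2_eq_square)
  ultimately show ?thesis
    using nonneg by (auto simp: log_concave_def)
qed

section \<open>Expansion of one step of the recurrence\<close>

text \<open>Summation by parts along the chain x, y, z. It serves the two mixed groups, with
  coefficients from \<open>f\<close> and \<open>g\<close> or from \<open>g\<close> and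
  \<open>h\<close>.\<close>

lemma q_ge_two_term_chain:
  assumes "nonneg_coeffs u1" "nonneg_coeffs v2" "nonneg_coeffs y"
    and "x \<ge>\<^sub>q y" "y \<ge>\<^sub>q z" "u1 + u2 \<ge>\<^sub>q v1 + v2"
  shows "nonneg_coeffs (u1 * x + u2 * y - v1 * y - v2 * z)"
proof -
  have "u1 * x + u2 * y - v1 * y - v2 * z =
      u1 * (x - y) + (u1 + u2 - (v1 + v2)) * y + v2 * (y - z)"
    by (simp add: algebra_simps)
  then show ?thesis
    using assms by (simp add: q_ge_iff nonneg_coeffs_add nonneg_coeffs_mult)
qed

text \<open>Treats one pair: the coefficient hypotheses enter only at (\<open>Suc k\<close>,
  \<open>l\<close>). The sequence \<open>c\<close> is a row padded with zeros, so its inequalities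
  can be asked for at all indices and the ends of the row need no separate treatment here.\<close>

lemma strong_log_concavity_step:
  fixes c f g h :: "nat \<Rightarrow> real poly"
  defines "b \<equiv> \<lambda>k. f k * c k + g k * c (Suc k) + h k * c (Suc (Suc k))"
  assumes "k < l"
    and c0: "\<And>i. nonneg_coeffs (c i)"
    and c: "\<And>i j. i < j \<Longrightarrow> c (Suc i) * c j \<ge>\<^sub>q c i * c (Suc j)"
    and f0: "\<And>i. nonneg_coeffs (f i)" and g0: "\<And>i. nonneg_coeffs (g i)"
    and h0: "\<And>i. nonneg_coeffs (h i)"
    and ff: "f (Suc k) * f l \<ge>\<^sub>q f k * f (Suc l)"
    and gg: "g (Suc k) * g l \<ge>\<^sub>q g k * g (Suc l)"
    and hh: "h (Suc k) * h l \<ge>\<^sub>q h k * h (Suc l)"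
    and fg: "f l * g (Suc k) + f (Suc k) * g l \<ge>\<^sub>q f (Suc l) * g k + f k * g (Suc l)"
    and gh: "g l * h (Suc k) + g (Suc k) * h l \<ge>\<^sub>q g (Suc l) * h k + g k * h (Suc l)"
    and fh: "f l * h (Suc k) + f (Suc k) * h l \<ge>\<^sub>q f k * h (Suc l) + f (Suc l) * h k"
    and gfh: "g (Suc k) * g l \<ge>\<^sub>q f (Suc l) * h k"
  shows "b (Suc k) * b l \<ge>\<^sub>q b k * b (Suc l)"
proof -
  note intros = nonneg_coeffs_add nonneg_coeffs_mult c0 f0 g0 h0
  define k1 k2 k3 l1 l2 l3 where "k1 = Suc k" and "k2 = Suc (Suc k)" and "k3 = Suc (Suc (Suc k))"
    and "l1 = Suc l" and "l2 = Suc (Suc l)" and "l3 = Suc (Suc (Suc l))"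
  note ind = k1_def k2_def k3_def l1_def l2_def l3_def
  have c1: "c k1 * c l \<ge>\<^sub>q c k * c l1" and c2: "c k1 * c l1 \<ge>\<^sub>q c k * c l2"
    and c3: "c k2 * c l1 \<ge>\<^sub>q c k1 * c l2" and c4: "c k1 * c l2 \<ge>\<^sub>q c k * c l3"
    and c5: "c k2 * c l2 \<ge>\<^sub>q c k1 * c l3"
    using \<open>k < l\<close> c[of k] c[of "Suc k"] by (simp_all add: ind)
  \<comment> \<open>When l = k + 1, both sides are the same product with its factors swapped; the
    strict condition i < j of \<open>c\<close> fails there. The same happens in
    \<open>c7\<close>.\<close>
  have c6: "c k2 * c l \<ge>\<^sub>q c k1 * c l1"
  proof (cases "l = Suc k")
    case False
    then show ?thesis using \<open>k < l\<close> c[of "Suc k" l] by (simp add: ind)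
  qed (simp add: ind mult.commute q_ge_refl)
  have c7: "c k3 * c l1 \<ge>\<^sub>q c k2 * c l2"
  proof (cases "l = Suc k")
    case False
    then show ?thesis using \<open>k < l\<close> c[of "Suc (Suc k)" "Suc l"] by (simp add: ind)
  qed (simp add: ind mult.commute q_ge_refl)
  text \<open>For \<open>l = k + 1\<close> the outermost product drops below \<open>c k2 * c l1\<close>, so only this comparison is uniform.\<close>
  have c8: "c k3 * c l \<ge>\<^sub>q c k1 * c l2"
  proof (cases "l = Suc k")
    case False
    have "c k3 * c l \<ge>\<^sub>q c k2 * c l1"
    proof (cases "l = Suc (Suc k)")
      case False
      with \<open>l \<noteq> Suc k\<close> \<open>k < l\<close> show ?thesis using c[of "Suc (Suc k)" l] by (simp add: ind)
    qed (simp add: ind mult.commute q_ge_refl)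
    with c3 show ?thesis
      unfolding q_ge_iff using nonneg_coeffs_add by fastforce
  qed (simp add: ind mult.commute q_ge_refl)

  \<comment> \<open>The groups \<open>s0\<close> to \<open>s4\<close> collect the index sums k + l +
    1 to k + l + 5.\<close>
  have s0: "nonneg_coeffs (f k1 * f l * (c k1 * c l) - f k * f l1 * (c k * c l1))"
  proof -
    have "f k1 * f l * (c k1 * c l) - f k * f l1 * (c k * c l1) =
        (f k1 * f l - f k * f l1) * (c k1 * c l) + f k * f l1 * (c k1 * c l - c k * c l1)"
      by (simp add: algebra_simps)
    then show ?thesis
      using ff c1 by (simp add: q_ge_iff intros flip: ind)
  qed
  have s1: "nonneg_coeffs (f l * g k1 * (c k2 * c l) + f k1 * g l * (c k1 * c l1)
      - f l1 * g k * (c k1 * c l1) - f k * g l1 * (c k * c l2))"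
    by (intro q_ge_two_term_chain intros c6 c2 fg[folded ind])
  have s2: "nonneg_coeffs (f l * h k1 * (c k3 * c l) + g k1 * g l * (c k2 * c l1)
      + f k1 * h l * (c k1 * c l2) - f l1 * h k * (c k2 * c l1) - g k * g l1 * (c k1 * c l2)
      - f k * h l1 * (c k * c l3))"
  proof -
    \<comment> \<open>The pivot is \<open>c k1 * c l2\<close>, which lies below both larger products
      whatever their mutual order. Splitting off the pivot lets \<open>g k1 * g l\<close> be used
      twice: against \<open>f l1 * h k\<close> on the difference, and against
      \<open>g k * g l1\<close> on the pivot itself.\<close>
    have "f l * h k1 * (c k3 * c l) + g k1 * g l * (c k2 * c l1)
        + f k1 * h l * (c k1 * c l2) - f l1 * h k * (c k2 * c l1) - g k * g l1 * (c k1 * c l2)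
        - f k * h l1 * (c k * c l3) =
      f l * h k1 * (c k3 * c l - c k1 * c l2)
        + (g k1 * g l - f l1 * h k) * (c k2 * c l1 - c k1 * c l2)
        + (f l * h k1 + f k1 * h l - (f k * h l1 + f l1 * h k)) * (c k1 * c l2)
        + (g k1 * g l - g k * g l1) * (c k1 * c l2)
        + f k * h l1 * (c k1 * c l2 - c k * c l3)"
      by (simp add: algebra_simps)
    then show ?thesis
      using c8 c3 c4 gfh fh gg by (simp only: q_ge_iff intros flip: ind)
  qed
  have s3: "nonneg_coeffs (g l * h k1 * (c k3 * c l1) + g k1 * h l * (c k2 * c l2)
      - g l1 * h k * (c k2 * c l2) - g k * h l1 * (c k1 * c l3))"
    by (intro q_ge_two_term_chain intros c7 c5 gh[folded ind])
  have s4: "nonneg_coeffs (h k1 * h l * (c k3 * c l2) - h k * h l1 * (c k2 * c l3))"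
  proof -
    have "c k3 * c l2 \<ge>\<^sub>q c k2 * c l3"
      using \<open>k < l\<close> c[of "Suc (Suc k)" "Suc (Suc l)"] by (simp add: ind)
    moreover have "h k1 * h l * (c k3 * c l2) - h k * h l1 * (c k2 * c l3) =
        (h k1 * h l - h k * h l1) * (c k3 * c l2) + h k * h l1 * (c k3 * c l2 - c k2 * c l3)"
      by (simp add: algebra_simps)
    ultimately show ?thesis
      using hh by (simp add: q_ge_iff intros flip: ind)
  qed
  have b: "b k = f k * c k + g k * c k1 + h k * c k2" "b k1 = f k1 * c k1 + g k1 * c k2 + h k1 * c k3"
    "b l = f l * c l + g l * c l1 + h l * c l2" "b l1 = f l1 * c l1 + g l1 * c l2 + h l1 * c l3"
    by (simp_all add: b_def ind)
  have "nonneg_coeffs (b k1 * b l - b k * b l1)"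
    using nonneg_coeffs_add[OF nonneg_coeffs_add[OF nonneg_coeffs_add[OF
      nonneg_coeffs_add[OF s0 s1] s2] s3] s4]
    by (simp add: b algebra_simps)
  then show ?thesis
    by (simp add: q_ge_iff ind)
qed

section \<open>Induction over the rows\<close>

theorem theorem4p1:
  fixes A :: "nat \<Rightarrow> int \<Rightarrow> real poly"
    and f g h :: "nat \<Rightarrow> nat \<Rightarrow> real poly"
  assumes lower_triangular: "\<And>n k :: nat. n < k \<Longrightarrow> A n (int k) = 0"
    and recurrence: "\<And>n k :: nat. 1 \<le> n \<Longrightarrow>
          A n (int k) = f n k * A (n - 1) (int k - 1) + g n k * A (n - 1) (int k)
                          + h n k * A (n - 1) (int k + 1)"
    and init_0: "A 0 0 = 1"
    and init_pos: "\<And>k :: nat. 0 < k \<Longrightarrow> A 0 (int k) = 0"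
    and boundary: "\<And>n :: nat. A n (- 1) = 0"
    and f_slc: "\<And>n :: nat. 1 \<le> n \<Longrightarrow> strongly_q_log_concave UNIV (f n)"
    and g_slc: "\<And>n :: nat. 1 \<le> n \<Longrightarrow> strongly_q_log_concave UNIV (g n)"
    and h_slc: "\<And>n :: nat. 1 \<le> n \<Longrightarrow> strongly_q_log_concave UNIV (h n)"
    and fg: "\<And>n k l :: nat. 1 \<le> k \<Longrightarrow> k \<le> l \<Longrightarrow> l \<le> n \<Longrightarrow>
          f n l * g n k + f n k * g n l \<ge>\<^sub>q f n (l + 1) * g n (k - 1) + f n (k - 1) * g n (l + 1)"
    and gh: "\<And>n k l :: nat. 1 \<le> k \<Longrightarrow> k \<le> l \<Longrightarrow> l \<le> n \<Longrightarrow>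
          g n l * h n k + g n k * h n l \<ge>\<^sub>q g n (l + 1) * h n (k - 1) + g n (k - 1) * h n (l + 1)"
    and fh: "\<And>n k l :: nat. 1 \<le> k \<Longrightarrow> k \<le> l \<Longrightarrow> l \<le> n \<Longrightarrow>
          f n l * h n k + f n k * h n l \<ge>\<^sub>q f n (k - 1) * h n (l + 1) + f n (l + 1) * h n (k - 1)"
    and gg: "\<And>n k l :: nat. 1 \<le> k \<Longrightarrow> k \<le> l \<Longrightarrow> l \<le> n \<Longrightarrow>
          g n k * g n l \<ge>\<^sub>q f n (l + 1) * h n (k - 1)"
  shows "\<forall>n :: nat. strongly_q_log_concave {..n} (\<lambda>k. A n (int k)) \<and>
           (\<forall>q :: real. 0 \<le> q \<longrightarrow> log_concave {..n} (\<lambda>k. poly (A n (int k)) q))"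
proof -
  have row: "strongly_q_log_concave {..n} (\<lambda>k. A n (int k))" for n
  proof (induction n)
    case 0
    show ?case
      by (rule strongly_q_log_concave_atMostI) (simp_all add: init_0 nonneg_coeffs_def coeff_1)
  next
    case (Suc n)
    note IH = strongly_q_log_concaveD[OF Suc]
    \<comment> \<open>The shift puts the boundary value \<open>A n (- 1)\<close> at index 0, so
      \<open>c\<close> lives on all naturals, with zeros at 0 and beyond index n + 1.\<close>
    define c where "c j = A n (int j - 1)" for j
    have c_0: "c 0 = 0"
      by (simp add: c_def boundary)
    have c_Suc: "c (Suc j) = A n (int j)" for j
      by (simp add: c_def)
    have c_nonneg: "nonneg_coeffs (c j)" for j
    proof (cases j)
      case (Suc i)
      then show ?thesis
        using IH(1)[of i] lower_triangular[of n i]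
        by (cases "i \<le> n") (simp_all add: c_Suc nonneg_coeffs_0)
    qed (simp add: c_0 nonneg_coeffs_0)
    have c_slc: "c (Suc i) * c j \<ge>\<^sub>q c i * c (Suc j)" if "i < j" for i j
    \<comment> \<open>In the padded range one factor on the right is zero: \<open>c 0\<close>, or
      \<open>c (Suc j)\<close>, which is the entry of row n at column j > n. Only nonnegativity of
      the left side remains.\<close>
    proof (cases "i = 0 \<or> n < j")
      case True
      then have "c i * c (Suc j) = 0"
        using lower_triangular[of n j] by (auto simp: c_0 c_Suc)
      then show ?thesis
        unfolding q_ge_iff by (simp only: diff_zero nonneg_coeffs_mult c_nonneg)
    next
      case False
      then obtain i' j' where "i = Suc i'" "j = Suc j'"
        using \<open>i < j\<close> by (cases i; cases j) auto
      then show ?thesis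
        using IH(2)[of i' j'] False that by (simp add: c_Suc)
    qed
    have rec: "A (Suc n) (int k) = f (Suc n) k * c k + g (Suc n) k * c (Suc k)
        + h (Suc n) k * c (Suc (Suc k))" for k
      using recurrence[of "Suc n" k] by (simp add: c_def add.commute)
    note slc_n = f_slc[of "Suc n", simplified] g_slc[of "Suc n", simplified]
      h_slc[of "Suc n", simplified]
    note nonneg = slc_n[THEN strongly_q_log_concaveD(1), OF UNIV_I]
    show ?case
    proof (rule strongly_q_log_concave_atMostI)
      fix k
      show "nonneg_coeffs (A (Suc n) (int k))"
        unfolding rec by (intro nonneg_coeffs_add nonneg_coeffs_mult nonneg c_nonneg)
    next
      fix k l
      assume "k < l" "l < Suc n"
      \<comment> \<open>The hypotheses are taken for row n + 1 at the pair (\<open>Suc k\<close>,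
        \<open>l\<close>), which lies in their range.\<close>
      then have kl: "1 \<le> Suc k" "Suc k \<le> l" "l \<le> Suc n"
        by auto
      show "A (Suc n) (int (Suc k)) * A (Suc n) (int l) \<ge>\<^sub>q A (Suc n) (int k) * A (Suc n) (int (Suc l))"
        unfolding rec
        using slc_n[THEN strongly_q_log_concaveD(2), OF \<open>k < l\<close> subset_UNIV]
          fg[OF kl] gh[OF kl] fh[OF kl] gg[OF kl]
        by (intro strong_log_concavity_step[of k l c "f (Suc n)" "g (Suc n)" "h (Suc n)"]
            \<open>k < l\<close> c_nonneg c_slc nonneg) simp_all
    qed
  qed
  then show ?thesis
    by (simp add: log_concave_poly)
qed

end
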